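(* Let $\mu$ be a positive rational number and $\mathbb{F}$ a field of characteristic $0$. With the addition $\langle A\rangle_\ell\boxplus_\ell\langle B\rangle_\ell:=\langle A\boxplus_\ell B\rangle_\ell$ (and the scalar multiplication $a\langle A\rangle_\ell:=\langle aA\rangle_\ell$, $a\in\mathbb{F}$), the quotient space $\Sigma_\mu^\ell:=\mathcal{M}_\mu/\!\sim_\ell$ is a vector space over $\mathbb{F}$. Correspondingly, with $\langle A\rangle_r\boxplus_r\langle B\rangle_r:=\langle A\boxplus_r B\rangle_r$ (and $a\langle A\rangle_r:=\langle aA\rangle_r$), the quotient space $\Sigma_\mu^r:=\mathcal{M}_\mu/\!\sim_r$ is a vector space over $\mathbb{F}$.
   Context: $\mathcal{M}_\mu$ is the set of all matrices over $\mathbb{F}$ whose size $m\times n$ satisfies $m/n=\mu$; $\otimes$ is the Kronecker product. $A\sim_\ell B$ means $A\otimes I_s=B\otimes I_t$ for some positive integers $s,t$; $A\sim_r B$ means $I_s\otimes A=I_t\otimes B$ for some positive integers $s,t$; $\langle A\rangle_\ell$, $\langle A\rangle_r$ are the corresponding equivalence classes. For $A\in\mathcal{M}_{m\times n}$, $B\in\mathcal{M}_{p\times q}$ in $\mathcal{M}_\mu$ and $t=\mathrm{lcm}(m,p)$: $A\boxplus_\ell B:=(A\otimes I_{t/m})+(B\otimes I_{t/p})$ and $A\boxplus_r B:=(I_{t/m}\otimes A)+(I_{t/p}\otimes B)$. *)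

theory Defs
  imports "Jordan_Normal_Form.VS_Connect"
begin

definition kronecker :: "'a :: field mat \<Rightarrow> 'a mat \<Rightarrow> 'a mat"  (infixl \<open>\<otimes>\<^sub>K\<close> 70) where
  "A \<otimes>\<^sub>K B = mat (dim_row A * dim_row B) (dim_col A * dim_col B)
     (\<lambda>(i, j). A $$ (i div dim_row B, j div dim_col B) * B $$ (i mod dim_row B, j mod dim_col B))"

text \<open>
  Matrices without rows or columns exist in the type of matrices; they are excluded explicitly
  (division by zero is total).
\<close>

definition mats_ratio :: "rat \<Rightarrow> 'a :: field mat set" where
  "mats_ratio \<mu> = {A. dim_row A > 0 \<and> dim_col A > 0 \<and> of_nat (dim_row A) / of_nat (dim_col A) = \<mu>}"

definition left_rel :: "rat \<Rightarrow> 'a :: field mat rel" where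
  "left_rel \<mu> = {(A, B). A \<in> mats_ratio \<mu> \<and> B \<in> mats_ratio \<mu> \<and>
     (\<exists>s>0. \<exists>t>0. A \<otimes>\<^sub>K 1\<^sub>m s = B \<otimes>\<^sub>K 1\<^sub>m t)}"

definition right_rel :: "rat \<Rightarrow> 'a :: field mat rel" where
  "right_rel \<mu> = {(A, B). A \<in> mats_ratio \<mu> \<and> B \<in> mats_ratio \<mu> \<and>
     (\<exists>s>0. \<exists>t>0. 1\<^sub>m s \<otimes>\<^sub>K A = 1\<^sub>m t \<otimes>\<^sub>K B)}"

definition left_add :: "'a :: field mat \<Rightarrow> 'a mat \<Rightarrow> 'a mat"  (infixl \<open>\<boxplus>\<^sub>l\<close> 65) where
  "A \<boxplus>\<^sub>l B = (let t = lcm (dim_row A) (dim_row B) in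
     (A \<otimes>\<^sub>K 1\<^sub>m (t div dim_row A)) + (B \<otimes>\<^sub>K 1\<^sub>m (t div dim_row B)))"

definition right_add :: "'a :: field mat \<Rightarrow> 'a mat \<Rightarrow> 'a mat"  (infixl \<open>\<boxplus>\<^sub>r\<close> 65) where
  "A \<boxplus>\<^sub>r B = (let t = lcm (dim_row A) (dim_row B) in
     (1\<^sub>m (t div dim_row A) \<otimes>\<^sub>K A) + (1\<^sub>m (t div dim_row B) \<otimes>\<^sub>K B))"

text \<open>
  The space of classes of \<open>r\<close>, with the operations on representatives lifted by the unions over all
  representatives that are usual for quotients; such a union is a single class only if
  the operation respects \<open>r\<close>. The zero is the class of the zero matrix of the smallest size with
  ratio \<open>\<mu>\<close>. The fields \<open>mult\<close> and \<open>one\<close> play no role in a module.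
\<close>

definition class_space ::
  "rat \<Rightarrow> 'a mat rel \<Rightarrow> ('a mat \<Rightarrow> 'a mat \<Rightarrow> 'a mat) \<Rightarrow> ('a :: field, 'a mat set) module" where
  "class_space \<mu> r f =
     \<lparr> carrier = mats_ratio \<mu> // r,
       mult = undefined,
       one = undefined,
       zero = r `` {0\<^sub>m (nat (fst (quotient_of \<mu>))) (nat (snd (quotient_of \<mu>)))},
       add = (\<lambda>X Y. \<Union>A\<in>X. \<Union>B\<in>Y. r `` {f A B}),
       smult = (\<lambda>a X. \<Union>A\<in>X. r `` {a \<cdot>\<^sub>m A}) \<rparr>"

definition Sigma_left :: "rat \<Rightarrow> ('a :: field, 'a mat set) module"  (\<open>\<Sigma>\<^sub>l\<close>) where
  "\<Sigma>\<^sub>l \<mu> = class_space \<mu> (left_rel \<mu>) (\<boxplus>\<^sub>l)"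

definition Sigma_right :: "rat \<Rightarrow> ('a :: field, 'a mat set) module"  (\<open>\<Sigma>\<^sub>r\<close>) where
  "\<Sigma>\<^sub>r \<mu> = class_space \<mu> (right_rel \<mu>) (\<boxplus>\<^sub>r)"

end

(* Kronecker multiplication by identity matrices, on either side, is an action E of the positive
   integers that multiplies both dimensions and is linear on matrices of equal size. Two matrices
   are equivalent when they have a common multiple, and since the ratio of the dimensions is fixed,
   finitely many classes always have representatives of one common size, on which the operations of
   the quotient are the ordinary matrix operations. The vector space axioms are thus inherited
   from the spaces of matrices of fixed size. *)
theory Submission
  imports Defs
begin

section \<open>Identities of the Kronecker product\<close>

lemma dim_row_kronecker [simp]: "dim_row (A \<otimes>\<^sub>K B) = dim_row A * dim_row B"
  and dim_col_kronecker [simp]: "dim_col (A \<otimes>\<^sub>K B) = dim_col A * dim_col B"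
  by (simp_all add: kronecker_def)

lemma index_kronecker:
  assumes "i < dim_row A * dim_row B" "j < dim_col A * dim_col B"
  shows "(A \<otimes>\<^sub>K B) $$ (i, j) =
    A $$ (i div dim_row B, j div dim_col B) * B $$ (i mod dim_row B, j mod dim_col B)"
  using assms by (simp add: kronecker_def)

text \<open>The bound forces \<open>n > 0\<close>, without which the remainder could not be bounded
  by \<open>n\<close>.\<close>

lemma div_mod_less_mult:
  fixes i :: nat
  assumes "i < m * n"
  shows "i div n < m" "i mod n < n"
  using assms by (auto simp: less_mult_imp_div_less intro!: mod_less_divisor Nat.gr0I)

text \<open>In mixed radix notation with lowest radix \<open>c\<close> and next radix
  \<open>b\<close>, both sides read off the second digit of \<open>i\<close>. Associativity needs
  this for the index into the middle factor.\<close>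

lemma div_mod_mult_eq: "(i mod (b * c)) div c = (i div c) mod (b::nat)"
proof (cases "c = 0")
  case False
  have "i mod (b * c) = c * (i div c mod b) + i mod c"
    by (simp add: mod_mult2_eq[symmetric] mult.commute)
  then show ?thesis using False by simp
qed simp

text \<open>A row index splits into three mixed radix digits, one for each factor, and both
  bracketings read the same digits; likewise for columns. What remains is associativity of the
  product of three entries.\<close>

lemma kronecker_assoc: "(A \<otimes>\<^sub>K B) \<otimes>\<^sub>K C = A \<otimes>\<^sub>K (B \<otimes>\<^sub>K C)"
proof (rule eq_matI)
  fix i j
  assume "i < dim_row (A \<otimes>\<^sub>K (B \<otimes>\<^sub>K C))" "j < dim_col (A \<otimes>\<^sub>K (B \<otimes>\<^sub>K C))"
  then have i: "i < dim_row A * (dim_row B * dim_row C)" "i < dim_row A * dim_row B * dim_row C"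
    and j: "j < dim_col A * (dim_col B * dim_col C)" "j < dim_col A * dim_col B * dim_col C"
    by (simp_all add: mult.assoc)
  show "((A \<otimes>\<^sub>K B) \<otimes>\<^sub>K C) $$ (i, j) = (A \<otimes>\<^sub>K (B \<otimes>\<^sub>K C)) $$ (i, j)"
    using i j div_mod_less_mult[OF i(1)] div_mod_less_mult[OF i(2)]
      div_mod_less_mult[OF j(1)] div_mod_less_mult[OF j(2)]
    by (simp add: index_kronecker mult.assoc div_mod_mult_eq mod_mod_cancel
        div_mult2_eq[symmetric] mult.commute[of "dim_row C"] mult.commute[of "dim_col C"])
qed (simp_all add: mult.assoc)

lemma kronecker_one_one: "1\<^sub>m m \<otimes>\<^sub>K 1\<^sub>m n = (1\<^sub>m (m * n) :: 'a :: field mat)"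
proof (rule eq_matI)
  fix i j
  assume "i < dim_row (1\<^sub>m (m * n) :: 'a mat)" "j < dim_col (1\<^sub>m (m * n) :: 'a mat)"
  then have i: "i < m * n" and j: "j < m * n" by simp_all
  \<comment> \<open>Quotient and remainder together determine a number, so the product of the two
    Kronecker deltas is again a delta.\<close>
  have "i div n = j div n \<and> i mod n = j mod n \<longleftrightarrow> i = j"
    by (metis div_mult_mod_eq)
  then show "(1\<^sub>m m \<otimes>\<^sub>K 1\<^sub>m n :: 'a mat) $$ (i, j) = 1\<^sub>m (m * n) $$ (i, j)"
    using i j div_mod_less_mult[OF i] div_mod_less_mult[OF j] by (auto simp: index_kronecker)
qed simp_all

lemma kronecker_one_right: "A \<otimes>\<^sub>K 1\<^sub>m 1 = A"
  by (rule eq_matI) (simp_all add: index_kronecker)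

lemma kronecker_one_left: "1\<^sub>m 1 \<otimes>\<^sub>K A = A"
  by (rule eq_matI) (simp_all add: index_kronecker)

lemma kronecker_add_left:
  assumes "A \<in> carrier_mat m n" "B \<in> carrier_mat m n"
  shows "(A + B) \<otimes>\<^sub>K C = (A \<otimes>\<^sub>K C) + (B \<otimes>\<^sub>K C)"
  using assms by (intro eq_matI) (auto simp: index_kronecker div_mod_less_mult distrib_right)

lemma kronecker_add_right:
  assumes "A \<in> carrier_mat m n" "B \<in> carrier_mat m n"
  shows "C \<otimes>\<^sub>K (A + B) = (C \<otimes>\<^sub>K A) + (C \<otimes>\<^sub>K B)"
  using assms by (intro eq_matI) (auto simp: index_kronecker div_mod_less_mult distrib_left)

lemma kronecker_smult_left: "(a \<cdot>\<^sub>m A) \<otimes>\<^sub>K B = a \<cdot>\<^sub>m (A \<otimes>\<^sub>K B)"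
  by (intro eq_matI) (auto simp: index_kronecker div_mod_less_mult)

lemma kronecker_smult_right: "A \<otimes>\<^sub>K (a \<cdot>\<^sub>m B) = a \<cdot>\<^sub>m (A \<otimes>\<^sub>K B)"
  by (intro eq_matI) (auto simp: index_kronecker div_mod_less_mult)

section \<open>Dilations: the properties shared by tensoring with identities on the left and on the
  right\<close>

locale dilation =
  fixes E :: "nat \<Rightarrow> 'a :: field mat \<Rightarrow> 'a mat" and \<mu> :: rat
  assumes ratio_pos: "\<mu> > 0"
    and dim_row_E [simp]: "dim_row (E s A) = s * dim_row A"
    and dim_col_E [simp]: "dim_col (E s A) = s * dim_col A"
    and E_1 [simp]: "E (Suc 0) A = A"
    and E_E: "E s (E t A) = E (s * t) A"
    and E_add: "A \<in> carrier_mat m n \<Longrightarrow> B \<in> carrier_mat m n \<Longrightarrow> E s (A + B) = E s A + E s B"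
    and E_smult: "E s (a \<cdot>\<^sub>m A) = a \<cdot>\<^sub>m E s A"
begin

definition rel :: "'a mat rel" where
  "rel = {(A, B). A \<in> mats_ratio \<mu> \<and> B \<in> mats_ratio \<mu> \<and> (\<exists>s>0. \<exists>t>0. E s A = E t B)}"

definition boxplus :: "'a mat \<Rightarrow> 'a mat \<Rightarrow> 'a mat" where
  "boxplus A B = (let t = lcm (dim_row A) (dim_row B) in
     E (t div dim_row A) A + E (t div dim_row B) B)"

definition space :: "('a, 'a mat set) module" where
  "space = class_space \<mu> rel boxplus"

abbreviation cls :: "'a mat \<Rightarrow> 'a mat set" where
  "cls A \<equiv> rel `` {A}"

text \<open>Homogeneity is enough: a zero matrix is 0 times itself, and scaling any matrix by 0
  gives the zero matrix of its size.\<close>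

lemma E_zero: "E s (0\<^sub>m m n) = 0\<^sub>m (s * m) (s * n)"
proof -
  have "E s (0\<^sub>m m n) = E s (0 \<cdot>\<^sub>m 0\<^sub>m m n)" by simp
  also have "\<dots> = 0 \<cdot>\<^sub>m E s (0\<^sub>m m n)" by (rule E_smult)
  also have "\<dots> = 0\<^sub>m (s * m) (s * n)" by (rule eq_matI) simp_all
  finally show ?thesis .
qed

lemma E_in_mats: "A \<in> mats_ratio \<mu> \<Longrightarrow> s > 0 \<Longrightarrow> E s A \<in> mats_ratio \<mu>"
  by (simp add: mats_ratio_def)

text \<open>The row count is \<open>\<mu>\<close> times the column count, and the nonzero
  \<open>\<mu>\<close> cancels. Hence matching row counts is enough to make two dilated matrices
  addable.\<close>

lemma mats_ratio_dims:
  assumes "A \<in> mats_ratio \<mu>" "B \<in> mats_ratio \<mu>" "s * dim_row A = t * dim_row B"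
  shows "s * dim_col A = t * dim_col B"
proof -
  have A: "rat_of_nat (dim_row A) = \<mu> * of_nat (dim_col A)"
    and B: "rat_of_nat (dim_row B) = \<mu> * of_nat (dim_col B)"
    using assms(1,2) unfolding mats_ratio_def by (simp_all add: divide_eq_eq)
  have "rat_of_nat (s * dim_row A) = of_nat (t * dim_row B)" using assms(3) by simp
  then have "\<mu> * rat_of_nat (s * dim_col A) = \<mu> * of_nat (t * dim_col B)"
    by (simp add: A B mult.left_commute)
  then show ?thesis using ratio_pos by (simp del: of_nat_mult)
qed

lemma mats_ratio_cong:
  "A \<in> mats_ratio \<mu> \<Longrightarrow> dim_row B = dim_row A \<Longrightarrow> dim_col B = dim_col A \<Longrightarrow> B \<in> mats_ratio \<mu>"
  by (simp add: mats_ratio_def)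

lemma equiv_rel: "equiv (mats_ratio \<mu>) rel"
proof (rule equivI)
  show "rel \<subseteq> mats_ratio \<mu> \<times> mats_ratio \<mu>" by (auto simp: rel_def)
  show "refl_on (mats_ratio \<mu>) rel"
    by (auto simp: rel_def refl_on_def intro!: exI[of _ "Suc 0"])
  show "sym rel" by (auto simp: rel_def sym_def) metis
  show "trans rel"
  proof (rule transI)
    fix A B C
    assume "(A, B) \<in> rel" "(B, C) \<in> rel"
    then obtain s t u v where pos: "s > 0" "t > 0" "u > 0" "v > 0"
      and eq: "E s A = E t B" "E u B = E v C"
      and mem: "A \<in> mats_ratio \<mu>" "C \<in> mats_ratio \<mu>"
      by (auto simp: rel_def)
    \<comment> \<open>The two equations meet in the dilation of \<open>B\<close> by
      \<open>u * t\<close>: the first is dilated by \<open>u\<close>, the second by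
      \<open>t\<close>.\<close>
    have "E (u * s) A = E t (E u B)" by (metis E_E eq(1) mult.commute)
    then have "E (u * s) A = E (t * v) C" by (simp add: eq(2) E_E)
    then show "(A, C) \<in> rel" 
      using mem pos nat_0_less_mult_iff unfolding rel_def by blast
  qed
qed

text \<open>The witnesses are \<open>s\<close> and 1. This allows a representative to be enlarged
  without leaving its class.\<close>

lemma E_rel:
  assumes "A \<in> mats_ratio \<mu>" "s > 0"
  shows "(A, E s A) \<in> rel"
proof -
  have "E s A = E (Suc 0) (E s A)" by simp
  then show ?thesis using assms E_in_mats[OF assms] unfolding rel_def by blast
qed

lemma cls_E: "A \<in> mats_ratio \<mu> \<Longrightarrow> s > 0 \<Longrightarrow> cls (E s A) = cls A"
  using equiv_class_eq[OF equiv_rel E_rel] by simp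

section \<open>The operations on classes\<close>

lemma boxplus_in_mats:
  assumes "A \<in> mats_ratio \<mu>" "B \<in> mats_ratio \<mu>"
  shows "boxplus A B \<in> mats_ratio \<mu>"
proof -
  let ?t = "lcm (dim_row A) (dim_row B)"
  have "dim_row B > 0" "?t > 0" using assms by (auto simp: mats_ratio_def lcm_pos_nat)
  \<comment> \<open>A matrix sum takes its dimensions from the second summand, so the ratio is read
    off from the dilated \<open>B\<close>.\<close>
  then have "E (?t div dim_row B) B \<in> mats_ratio \<mu>"
    using assms(2) by (intro E_in_mats) (auto simp: div_greater_zero_iff intro: dvd_imp_le)
  then show ?thesis
    by (rule mats_ratio_cong) (simp_all add: boxplus_def Let_def)
qed

text \<open>Every common row count is a multiple of the least one, and dilating by the quotient
  turns the sum at the least size into the sum at the given size. Thus addition of classes may be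
  computed at any common size.\<close>

lemma boxplus_rel:
  assumes "A \<in> mats_ratio \<mu>" "B \<in> mats_ratio \<mu>" "s > 0" "s * dim_row A = t * dim_row B"
  shows "(boxplus A B, E s A + E t B) \<in> rel"
proof -
  let ?l = "lcm (dim_row A) (dim_row B)"
  define p where "p = ?l div dim_row A"
  define q where "q = ?l div dim_row B"
  have pos: "dim_row A > 0" "dim_row B > 0" using assms(1,2) by (auto simp: mats_ratio_def)
  have pl: "p * dim_row A = ?l" and ql: "q * dim_row B = ?l" by (simp_all add: p_def q_def)
  have "dim_row B dvd s * dim_row A" using assms(4) by simp
  then have "?l dvd s * dim_row A" by simp
  \<comment> \<open>The factor \<open>k\<close> relates the given size to the least one; it also
    divides both multipliers, as \<open>s = k * p\<close> and \<open>t = k * q\<close>.\<close>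
  then obtain k where k: "s * dim_row A = ?l * k" by (rule dvdE)
  have "s * dim_row A = k * p * dim_row A" using k pl by simp
  then have s: "s = k * p" using pos by simp
  have "t * dim_row B = k * q * dim_row B" using k ql assms(4) by simp
  then have t: "t = k * q" using pos by simp
  have "k > 0" using assms(3) s by (cases k) auto
  \<comment> \<open>Additivity of \<open>E\<close> needs summands of one size: both row counts are
    the least common multiple, and the column counts agree because the ratio is fixed.\<close>
  have "E p A \<in> carrier_mat (p * dim_row A) (p * dim_col A)" by auto
  moreover have "E q B \<in> carrier_mat (p * dim_row A) (p * dim_col A)"
    using pl ql mats_ratio_dims[OF assms(1,2), of p q] by auto
  ultimately have "E k (E p A + E q B) = E k (E p A) + E k (E q B)" by (rule E_add)
  then have "E k (boxplus A B) = E s A + E t B"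
    by (simp add: boxplus_def Let_def E_E s t p_def q_def)
  then show ?thesis using E_rel[OF boxplus_in_mats[OF assms(1,2)] \<open>k > 0\<close>] by simp
qed

lemma boxplus_cong:
  assumes "(A, A') \<in> rel" "(B, B') \<in> rel"
  shows "(boxplus A B, boxplus A' B') \<in> rel"
proof -
  obtain s s' t t' where pos: "s > 0" "s' > 0" "t > 0" "t' > 0"
    and eq: "E s A = E s' A'" "E t B = E t' B'"
    and mem: "A \<in> mats_ratio \<mu>" "A' \<in> mats_ratio \<mu>" "B \<in> mats_ratio \<mu>" "B' \<in> mats_ratio \<mu>"
    using assms by (auto simp: rel_def)
  \<comment> \<open>Here \<open>n\<close> is the row count of the matrix common to \<open>A\<close>
    and \<open>A'\<close>, and \<open>m\<close> that of the one common to \<open>B\<close> and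
    \<open>B'\<close>. Dilating the first by \<open>m\<close> and the second by \<open>n\<close>
    brings all four to \<open>m * n\<close> rows.\<close>
  define m where "m = t * dim_row B"
  define n where "n = s * dim_row A"
  have m: "m = t' * dim_row B'" and n: "n = s' * dim_row A'"
    using arg_cong[OF eq(1), of dim_row] arg_cong[OF eq(2), of dim_row]
    by (simp_all add: m_def n_def)
  have "m > 0" using pos mem by (simp add: m_def mats_ratio_def)
  have "(boxplus A B, E (m * s) A + E (n * t) B) \<in> rel"
    using mem pos \<open>m > 0\<close> by (intro boxplus_rel) (simp_all add: m_def n_def)
  moreover have "(boxplus A' B', E (m * s') A' + E (n * t') B') \<in> rel"
    using mem pos \<open>m > 0\<close> by (intro boxplus_rel) (simp_all add: m n)
  \<comment> \<open>Peeling off the outer dilations by \<open>m\<close> and \<open>n\<close> leaves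
    the equal pairs in \<open>eq\<close>.\<close>
  moreover have "E (m * s) A + E (n * t) B = E (m * s') A' + E (n * t') B'"
    by (simp flip: E_E add: eq)
  ultimately show ?thesis
    using equiv_rel by (metis equivE symE transE)
qed

lemma smult_in_mats: "A \<in> mats_ratio \<mu> \<Longrightarrow> a \<cdot>\<^sub>m A \<in> mats_ratio \<mu>"
  by (simp add: mats_ratio_def)

lemma smult_cong: "(A, B) \<in> rel \<Longrightarrow> (a \<cdot>\<^sub>m A, a \<cdot>\<^sub>m B) \<in> rel"
  by (auto simp: rel_def smult_in_mats E_smult) metis

lemma carrier_space: "carrier space = mats_ratio \<mu> // rel"
  by (simp add: space_def class_space_def)

text \<open>By \<open>boxplus_cong\<close> all classes in the union that defines the addition
  coincide, so the union is a single class.\<close>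

lemma add_cls:
  assumes "A \<in> mats_ratio \<mu>" "B \<in> mats_ratio \<mu>"
  shows "cls A \<oplus>\<^bsub>space\<^esub> cls B = cls (boxplus A B)"
proof -
  have "congruent2 rel rel (\<lambda>A B. cls (boxplus A B))"
    by (auto simp: congruent2_def intro!: equiv_class_eq[OF equiv_rel] boxplus_cong)
  from UN_equiv_class2[OF equiv_rel equiv_rel this assms]
  show ?thesis by (simp add: space_def class_space_def)
qed

lemma smult_cls:
  assumes "A \<in> mats_ratio \<mu>"
  shows "a \<odot>\<^bsub>space\<^esub> cls A = cls (a \<cdot>\<^sub>m A)"
proof -
  have "congruent rel (\<lambda>A. cls (a \<cdot>\<^sub>m A))"
    by (auto simp: congruent_def intro!: equiv_class_eq[OF equiv_rel] smult_cong)
  from UN_equiv_class[OF equiv_rel this assms]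
  show ?thesis by (simp add: space_def class_space_def)
qed

section \<open>Computing with representatives of one size\<close>

definition sized :: "nat \<Rightarrow> nat \<Rightarrow> bool" where
  "sized m n \<longleftrightarrow> m > 0 \<and> n > 0 \<and> of_nat m / of_nat n = \<mu>"

lemma sized_mats: "sized m n \<Longrightarrow> A \<in> carrier_mat m n \<Longrightarrow> A \<in> mats_ratio \<mu>"
  by (auto simp: sized_def mats_ratio_def)

text \<open>For equal row counts the least common multiple is that count itself, so both dilation
  factors are 1.\<close>

lemma add_cls_sized:
  assumes "sized m n" "A \<in> carrier_mat m n" "B \<in> carrier_mat m n"
  shows "cls A \<oplus>\<^bsub>space\<^esub> cls B = cls (A + B)"
proof -
  have "boxplus A B = A + B" using assms by (auto simp: boxplus_def Let_def sized_def)
  then show ?thesis using add_cls sized_mats assms by metis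
qed

lemma smult_cls_sized:
  assumes "sized m n" "A \<in> carrier_mat m n"
  shows "a \<odot>\<^bsub>space\<^esub> cls A = cls (a \<cdot>\<^sub>m A)"
  using smult_cls sized_mats assms by blast

lemma cls_in_carrier:
  "sized m n \<Longrightarrow> A \<in> carrier_mat m n \<Longrightarrow> cls A \<in> carrier space"
  by (auto simp: carrier_space intro!: quotientI sized_mats)

text \<open>The numerator is positive because \<open>\<mu>\<close> is, so \<open>nat\<close>
  truncates nothing.\<close>

lemma sized_lowest_terms:
  "sized (nat (fst (quotient_of \<mu>))) (nat (snd (quotient_of \<mu>)))"
proof -
  obtain p q where pq: "quotient_of \<mu> = (p, q)" by (cases "quotient_of \<mu>")
  have q: "q > 0" and mu: "\<mu> = of_int p / of_int q"
    using pq quotient_of_denom_pos quotient_of_div by auto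
  then have "p > 0" using ratio_pos by (simp add: zero_less_divide_iff)
  then show ?thesis using q by (simp add: sized_def pq flip: mu)
qed

lemma zero_in_carrier: "\<zero>\<^bsub>space\<^esub> \<in> carrier space"
  using cls_in_carrier[OF sized_lowest_terms zero_carrier_mat]
  by (simp add: space_def class_space_def)

text \<open>The zero of the space is fixed at the size in lowest terms. Any other size of ratio
  \<open>\<mu>\<close> is an integer multiple of that one, and dilation takes zero matrices to zero
  matrices.\<close>

lemma zero_sized:
  assumes "sized m n"
  shows "\<zero>\<^bsub>space\<^esub> = cls (0\<^sub>m m n)"
proof -
  obtain p q where pq: "quotient_of \<mu> = (p, q)" by (cases "quotient_of \<mu>")
  have cop: "coprime p q" and mu: "\<mu> = of_int p / of_int q"
    using pq quotient_of_coprime quotient_of_div by auto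
  have low: "sized (nat p) (nat q)" and p: "p > 0" and q: "q > 0"
    using sized_lowest_terms by (auto simp: pq sized_def)
  have "rat_of_nat m / of_nat n = of_int p / of_int q" and mn: "m > 0" "n > 0"
    using assms by (simp_all add: sized_def flip: mu)
  then have "rat_of_int (int m * q) = of_int (p * int n)" using q by (simp add: field_simps)
  then have eq: "int m * q = p * int n" by (simp only: of_int_eq_iff)
  \<comment> \<open>This is where lowest terms matter: \<open>p\<close> divides
    \<open>int m * q\<close> and is coprime to \<open>q\<close>.\<close>
  then have "p dvd int m" using cop by (metis coprime_dvd_mult_left_iff dvd_triv_left)
  then obtain k where k: "int m = p * k" by (rule dvdE)
  have "int n = q * k" using eq k p by (simp add: mult.assoc mult.commute[of q])
  have "k > 0" using k mn p by (metis of_nat_0_less_iff zero_less_mult_pos)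
  \<comment> \<open>Back from integers to naturals, where \<open>nat k\<close> can serve as a
    dilation factor.\<close>
  have "m = nat (int m)" "n = nat (int n)" by simp_all
  then have mn': "m = nat k * nat p" "n = nat k * nat q"
    using \<open>k > 0\<close> p q unfolding k \<open>int n = q * k\<close>
    by (simp_all add: nat_mult_distrib mult.commute)
  have "cls (E (nat k) (0\<^sub>m (nat p) (nat q))) = cls (0\<^sub>m (nat p) (nat q))"
    using \<open>k > 0\<close> low by (intro cls_E) (auto intro: sized_mats)
  then show ?thesis by (simp add: E_zero mn' space_def class_space_def pq)
qed

text \<open>Associativity involves three classes, the most that any axiom does; for axioms with
  fewer, an argument is repeated.\<close>

lemma common_size:
  assumes "X \<in> carrier space" "Y \<in> carrier space" "Z \<in> carrier space"
  obtains m n A B C where "sized m n"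
    "A \<in> carrier_mat m n" "B \<in> carrier_mat m n" "C \<in> carrier_mat m n"
    "X = cls A" "Y = cls B" "Z = cls C"
proof -
  obtain A B C where mem: "A \<in> mats_ratio \<mu>" "B \<in> mats_ratio \<mu>" "C \<in> mats_ratio \<mu>"
    and XYZ: "X = cls A" "Y = cls B" "Z = cls C"
    using assms unfolding carrier_space quotient_def by blast
  \<comment> \<open>Each factor is the product of the other two row counts, so every dilated matrix
    has the product of all three as its row count.\<close>
  define a b c where "a = dim_row B * dim_row C" and "b = dim_row A * dim_row C"
    and "c = dim_row A * dim_row B"
  have pos: "a > 0" "b > 0" "c > 0" using mem by (simp_all add: a_def b_def c_def mats_ratio_def)
  have rows: "b * dim_row B = a * dim_row A" "c * dim_row C = a * dim_row A"
    by (simp_all add: a_def b_def c_def)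
  note cols = mats_ratio_dims[OF mem(2,1) rows(1)] mats_ratio_dims[OF mem(3,1) rows(2)]
  show ?thesis
  proof (rule that)
    show "sized (a * dim_row A) (a * dim_col A)"
      using E_in_mats[OF mem(1) pos(1)] by (auto simp: sized_def mats_ratio_def)
    show "E a A \<in> carrier_mat (a * dim_row A) (a * dim_col A)" by auto
    show "E b B \<in> carrier_mat (a * dim_row A) (a * dim_col A)" using rows cols by auto
    show "E c C \<in> carrier_mat (a * dim_row A) (a * dim_col A)" using rows cols by auto
  qed (simp_all add: XYZ cls_E mem pos)
qed

section \<open>The vector space axioms\<close>

lemma vectorspace_space: "vectorspace class_ring space"
proof -
  \<comment> \<open>Once a size is fixed, these rules move every operation inside
    \<open>cls\<close>, where the matching matrix identity applies.\<close>
  note ops = add_cls_sized smult_cls_sized zero_sized cls_in_carrier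
  have "abelian_group space"
  proof (rule abelian_groupI)
    fix X Y Z
    assume XYZ: "X \<in> carrier space" "Y \<in> carrier space" "Z \<in> carrier space"
    show "X \<oplus>\<^bsub>space\<^esub> Y \<oplus>\<^bsub>space\<^esub> Z = X \<oplus>\<^bsub>space\<^esub> (Y \<oplus>\<^bsub>space\<^esub> Z)"
      by (rule common_size[OF XYZ]) (simp add: ops)
  next
    fix X Y
    assume XY: "X \<in> carrier space" "Y \<in> carrier space"
    obtain m n A B where mn: "sized m n"
      and AB: "A \<in> carrier_mat m n" "B \<in> carrier_mat m n" "X = cls A" "Y = cls B"
      by (rule common_size[OF XY XY(1)])
    show "X \<oplus>\<^bsub>space\<^esub> Y \<in> carrier space" using AB by (simp add: ops[OF mn])
    show "X \<oplus>\<^bsub>space\<^esub> Y = Y \<oplus>\<^bsub>space\<^esub> X"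
      using AB by (simp add: ops[OF mn] comm_add_mat[OF AB(1,2)])
  next
    show "\<zero>\<^bsub>space\<^esub> \<in> carrier space" by (rule zero_in_carrier)
  next
    fix X
    assume X: "X \<in> carrier space"
    obtain m n A where mn: "sized m n" and A: "A \<in> carrier_mat m n" "X = cls A"
      by (rule common_size[OF X X X])
    show "\<zero>\<^bsub>space\<^esub> \<oplus>\<^bsub>space\<^esub> X = X" using A by (simp add: ops[OF mn])
    \<comment> \<open>Negation of a representative gives the additive inverse;
      \<open>zero_sized\<close> identifies the class of the resulting zero matrix with the zero of
      the space.\<close>
    have "cls (- A) \<in> carrier space" "cls (- A) \<oplus>\<^bsub>space\<^esub> X = \<zero>\<^bsub>space\<^esub>"
      using A by (simp_all add: ops[OF mn])
    then show "\<exists>Y\<in>carrier space. Y \<oplus>\<^bsub>space\<^esub> X = \<zero>\<^bsub>space\<^esub>" by blast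
  qed
  \<comment> \<open>A vector space is a module over a field; the module part asks for a commutative
    ring, which is extracted from the field.\<close>
  moreover have "field (class_ring :: 'a ring)" by (rule class_field)
  moreover from this have "cring (class_ring :: 'a ring)" by (intro domain.axioms(1) field.axioms(1))
  ultimately show ?thesis
    unfolding vectorspace_def
  proof (intro conjI moduleI)
    fix a b X
    assume X: "X \<in> carrier space"
    obtain m n A where mn: "sized m n" and A: "A \<in> carrier_mat m n" "X = cls A"
      by (rule common_size[OF X X X])
    show "a \<odot>\<^bsub>space\<^esub> X \<in> carrier space" using A by (simp add: ops[OF mn])
    show "(a \<oplus>\<^bsub>class_ring\<^esub> b) \<odot>\<^bsub>space\<^esub> X = a \<odot>\<^bsub>space\<^esub> X \<oplus>\<^bsub>space\<^esub> b \<odot>\<^bsub>space\<^esub> X"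
      using A by (simp add: ops[OF mn] add_smult_distrib_right_mat[OF A(1)])
    have "(a * b) \<cdot>\<^sub>m A = a \<cdot>\<^sub>m (b \<cdot>\<^sub>m A)" by (rule eq_matI) (simp_all add: mult.assoc)
    then show "(a \<otimes>\<^bsub>class_ring\<^esub> b) \<odot>\<^bsub>space\<^esub> X = a \<odot>\<^bsub>space\<^esub> (b \<odot>\<^bsub>space\<^esub> X)"
      using A by (simp add: ops[OF mn])
    have "1 \<cdot>\<^sub>m A = A" by (rule eq_matI) simp_all
    then show "\<one>\<^bsub>class_ring\<^esub> \<odot>\<^bsub>space\<^esub> X = X" using A by (simp add: ops[OF mn])
  next
    fix a X Y
    assume XY: "X \<in> carrier space" "Y \<in> carrier space"
    obtain m n A B where mn: "sized m n"
      and AB: "A \<in> carrier_mat m n" "B \<in> carrier_mat m n" "X = cls A" "Y = cls B"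
      by (rule common_size[OF XY XY(1)])
    show "a \<odot>\<^bsub>space\<^esub> (X \<oplus>\<^bsub>space\<^esub> Y) = a \<odot>\<^bsub>space\<^esub> X \<oplus>\<^bsub>space\<^esub> a \<odot>\<^bsub>space\<^esub> Y"
      using AB by (simp add: ops[OF mn] add_smult_distrib_left_mat[OF AB(1,2)])
  qed
qed

end

section \<open>The left and right instances\<close>

lemma dilation_left: "\<mu> > 0 \<Longrightarrow> dilation (\<lambda>s A. A \<otimes>\<^sub>K 1\<^sub>m s) \<mu>"
  by unfold_locales
    (simp_all add: kronecker_assoc kronecker_one_one kronecker_one_right[simplified]
      kronecker_smult_left kronecker_add_left mult.commute)

text \<open>Associativity gathers the identities in front, with sizes in the order
  \<open>s * t\<close>. For the left relation they gather behind, in the order \<open>t * s\<close>,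
  hence the appeal to commutativity there.\<close>

lemma dilation_right: "\<mu> > 0 \<Longrightarrow> dilation (\<lambda>s A. 1\<^sub>m s \<otimes>\<^sub>K A) \<mu>"
  by unfold_locales
    (simp_all flip: kronecker_assoc add: kronecker_one_one kronecker_one_left[simplified]
      kronecker_smult_right kronecker_add_right)

theorem theorem58:
  fixes \<mu> :: rat
  assumes "\<mu> > 0"
  shows
    "(equiv (mats_ratio \<mu>) (left_rel \<mu> :: ('a :: field_char_0) mat rel) \<and>
     carrier (\<Sigma>\<^sub>l \<mu>) = mats_ratio \<mu> // (left_rel \<mu> :: 'a mat rel) \<and>
     (\<forall>A\<in>mats_ratio \<mu>. \<forall>B\<in>mats_ratio \<mu>.
        left_rel \<mu> `` {A :: 'a mat} \<oplus>\<^bsub>\<Sigma>\<^sub>l \<mu>\<^esub> left_rel \<mu> `` {B} = left_rel \<mu> `` {A \<boxplus>\<^sub>l B}) \<and>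
     (\<forall>a. \<forall>A\<in>mats_ratio \<mu>.
        a \<odot>\<^bsub>\<Sigma>\<^sub>l \<mu>\<^esub> (left_rel \<mu> `` {A :: 'a mat}) = left_rel \<mu> `` {a \<cdot>\<^sub>m A}) \<and>
     vectorspace class_ring (\<Sigma>\<^sub>l \<mu> :: ('a, 'a mat set) module)) \<and>
     (equiv (mats_ratio \<mu>) (right_rel \<mu> :: 'a mat rel) \<and>
     carrier (\<Sigma>\<^sub>r \<mu>) = mats_ratio \<mu> // (right_rel \<mu> :: 'a mat rel) \<and>
     (\<forall>A\<in>mats_ratio \<mu>. \<forall>B\<in>mats_ratio \<mu>.
        right_rel \<mu> `` {A :: 'a mat} \<oplus>\<^bsub>\<Sigma>\<^sub>r \<mu>\<^esub> right_rel \<mu> `` {B} = right_rel \<mu> `` {A \<boxplus>\<^sub>r B}) \<and>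
     (\<forall>a. \<forall>A\<in>mats_ratio \<mu>.
        a \<odot>\<^bsub>\<Sigma>\<^sub>r \<mu>\<^esub> (right_rel \<mu> `` {A :: 'a mat}) = right_rel \<mu> `` {a \<cdot>\<^sub>m A}) \<and>
     vectorspace class_ring (\<Sigma>\<^sub>r \<mu> :: ('a, 'a mat set) module))"
proof -
  interpret L: dilation "\<lambda>s A. (A :: 'a mat) \<otimes>\<^sub>K 1\<^sub>m s" \<mu>
    using assms by (rule dilation_left)
  interpret R: dilation "\<lambda>s A. 1\<^sub>m s \<otimes>\<^sub>K (A :: 'a mat)" \<mu>
    using assms by (rule dilation_right)
  \<comment> \<open>The relation, addition and space of each instance unfold to the concrete ones,
    so the general results transfer by rewriting.\<close>
  have rel: "L.rel = left_rel \<mu>" "R.rel = right_rel \<mu>"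
    by (simp_all add: L.rel_def R.rel_def left_rel_def right_rel_def)
  have plus: "L.boxplus = (\<boxplus>\<^sub>l)" "R.boxplus = (\<boxplus>\<^sub>r)"
    by (intro ext, simp add: L.boxplus_def R.boxplus_def left_add_def right_add_def)+
  have space: "L.space = \<Sigma>\<^sub>l \<mu>" "R.space = \<Sigma>\<^sub>r \<mu>"
    by (simp_all add: L.space_def R.space_def Sigma_left_def Sigma_right_def rel plus)
  show ?thesis
    using L.equiv_rel L.carrier_space L.add_cls L.smult_cls L.vectorspace_space
      R.equiv_rel R.carrier_space R.add_cls R.smult_cls R.vectorspace_space
    unfolding rel plus space by blast
qed

end
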